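(* Let $n\ge 3$ be an integer and suppose that $\binom{n}{L(n)-1}>\frac{2^n}{n+1}$. Then $$f(n)=f(n-1)=f(n-2)=L(n)-1\quad\text{and}\quad L(n)=L(n+1)=L(n+2)=f(n)+1.$$
   Context: For an integer $n\ge 2$, $f(n)$ denotes the least positive integer $k$ such that $\binom{n}{k}>\frac{2^n}{n+1}$ (so $f(2)=1$). For an integer $n\ge 3$, $L(n)$ denotes the least positive integer $k$ such that $\binom{n}{k}>\frac{2^n}{n}$. (Such $k$ exist in these ranges. For $n=3$ the hypothesis of the claim fails, since $L(3)=1$ and $\binom{3}{0}=1<2=\frac{2^3}{4}$, so $f(1)$ is never needed.) *)

theory Defs
  imports Complex_Main
begin

text \<open>
  The two thresholds are exact (real) quotients. A witness \<open>k\<close> exists for \<open>binom_f\<close> when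
  \<open>n \<ge> 2\<close> and for \<open>binom_L\<close> when \<open>n \<ge> 3\<close>; for smaller \<open>n\<close> there is no witness and the
  value of \<^const>\<open>Least\<close> is unspecified.
\<close>

definition binom_f :: "nat \<Rightarrow> nat" where
  "binom_f n = (LEAST k. k > 0 \<and> real (n choose k) > 2 ^ n / (real n + 1))"

definition binom_L :: "nat \<Rightarrow> nat" where
  "binom_L n = (LEAST k. k > 0 \<and> real (n choose k) > 2 ^ n / real n)"

end

theory Submission
  imports Defs
begin

text \<open>
  Put \<open>k = L(n) - 1\<close>. The hypothesis excludes \<open>k = 0\<close>, because \<open>(n choose 0) = 1 \<le> 2^n/(n+1)\<close>, so
  it combines with the minimality of \<open>L(n)\<close> to give \<open>2^n/(n+1) < (n choose k) \<le> 2^n/n\<close>. The symmetry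
  of the binomial coefficients puts \<open>L(n)\<close> in the left half of the row, so that \<open>2k + 2 \<le> n\<close>.

  Since rows increase up to the middle, an equation such as \<open>f(n-2) = k\<close> only says that a threshold
  lies between two neighbouring entries of row \<open>n-2\<close>. Each entry of rows \<open>n-2, ..., n+2\<close> that is
  needed is \<open>(n choose k)\<close> times an explicit rational function of \<open>n\<close> and \<open>k\<close>, so the narrow window
  for \<open>(n choose k)\<close> turns each comparison into a polynomial inequality in \<open>n\<close> and \<open>k\<close>. For the
  entries two rows straight above and below, \<open>(n-2 choose k-1)\<close> and \<open>(n+2 choose k+1)\<close>, this
  inequality is exactly that of the arithmetic and geometric means. The others follow from
  \<open>2k + 2 \<le> n\<close>.
\<close>

section \<open>Existence and location of the first large entry\<close>

text \<open>
  If all inner entries of the row were at most \<open>2^n/n\<close>, the \<open>n-1\<close> of them together with the two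
  outer ones could not add up to \<open>2^n\<close>, because \<open>2^n/n > 2\<close>.
\<close>

lemma ex_binomial_greater_average:
  fixes n :: nat
  assumes "n \<ge> 3"
  shows "\<exists>k>0. real (n choose k) > 2 ^ n / real n"
proof (rule ccontr)
  assume "\<not> ?thesis"
  then have le: "real (n choose k) \<le> 2 ^ n / real n" if "k \<in> {0<..<n}" for k
    using that by (simp add: not_less) (metis less_irrefl)
  have pow: "2 * n < 2 ^ n"
    using assms by (induction n rule: dec_induct) auto
  have "{..n} = insert 0 (insert n {0<..<n})"
    using assms by auto
  then have "2 ^ n = 2 + (\<Sum>k\<in>{0<..<n}. n choose k)"
    using choose_row_sum[of n] assms by simp
  then have "(2::real) ^ n = 2 + (\<Sum>k\<in>{0<..<n}. real (n choose k))"
    by (metis of_nat_add of_nat_numeral of_nat_power of_nat_sum)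
  also have "\<dots> \<le> 2 + real (card {0<..<n}) * (2 ^ n / real n)"
    using sum_bounded_above[of "{0<..<n}", OF le] by simp
  also have "\<dots> = 2 + 2 ^ n - 2 ^ n / real n"
    using assms by (simp add: field_simps of_nat_diff)
  finally have "2 ^ n \<le> 2 * real n"
    using assms by (simp add: field_simps)
  moreover have "2 * real n < 2 ^ n"
    using pow by (metis of_nat_less_iff of_nat_mult of_nat_numeral of_nat_power)
  ultimately show False by simp
qed

lemma binom_L_greater:
  fixes n :: nat
  assumes "n \<ge> 3"
  shows "binom_L n > 0" and "real (n choose binom_L n) > 2 ^ n / real n"
  using LeastI_ex[OF ex_binomial_greater_average[OF assms]] unfolding binom_L_def by auto

lemma binom_L_le:
  assumes "k > 0" and "real (n choose k) > 2 ^ n / real n"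
  shows "binom_L n \<le> k"
  unfolding binom_L_def using assms by (intro Least_le) simp

text \<open>
  The entry at \<open>n - L(n)\<close> is as large as the one at \<open>L(n)\<close>, so minimality forbids \<open>n - L(n) < L(n)\<close>.
\<close>

lemma binom_L_le_half:
  fixes n :: nat
  assumes "n \<ge> 3"
  shows "2 * binom_L n \<le> n"
proof -
  have "n < 2 ^ n" by simp
  then have "real n < 2 ^ n" 
    by (metis of_nat_less_iff of_nat_numeral of_nat_power)
  then have gt1: "(1::real) < 2 ^ n / real n"
    using assms by simp
  have "binom_L n < n"
  proof (rule ccontr)
    assume "\<not> binom_L n < n"
    then have "n choose binom_L n \<le> 1"
      by (cases "binom_L n = n") (auto simp: binomial_eq_0)
    with gt1 binom_L_greater(2)[OF assms] show False by linarith
  qed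
  moreover from this have "n choose (n - binom_L n) = n choose binom_L n"
    using binomial_symmetric[of "binom_L n" n] by simp
  ultimately have "binom_L n \<le> n - binom_L n"
    using binom_L_greater[OF assms] by (intro binom_L_le) auto
  with \<open>binom_L n < n\<close> show ?thesis by simp
qed

section \<open>Characterising a first large entry by its two neighbours\<close>

lemma Least_binomial_greater_eqI:
  fixes t :: real
  assumes "k > 0" and "2 * k \<le> n"
    and gt: "t < real (n choose k)" and le: "real (n choose (k - 1)) \<le> t"
  shows "(LEAST j. j > 0 \<and> t < real (n choose j)) = k"
proof (rule Least_equality)
  show "k > 0 \<and> t < real (n choose k)" using assms by simp
next
  fix j assume j: "j > 0 \<and> t < real (n choose j)"
  show "k \<le> j"
  proof (rule ccontr)
    assume "\<not> k \<le> j"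
    then have "n choose j \<le> n choose (k - 1)"
      using assms by (intro binomial_mono) auto
    with j le show False by linarith
  qed
qed

lemma binom_f_eqI:
  assumes "k > 0" and "2 * k \<le> n"
    and "2 ^ n / (real n + 1) < real (n choose k)" and "real (n choose (k - 1)) \<le> 2 ^ n / (real n + 1)"
  shows "binom_f n = k"
  unfolding binom_f_def by (rule Least_binomial_greater_eqI[OF assms])

lemma binom_L_eqI:
  assumes "k > 0" and "2 * k \<le> n"
    and "2 ^ n / real n < real (n choose k)" and "real (n choose (k - 1)) \<le> 2 ^ n / real n"
  shows "binom_L n = k"
  unfolding binom_L_def by (rule Least_binomial_greater_eqI[OF assms])

section \<open>Moving between neighbouring entries of Pascal's triangle\<close>

lemma binomial_next_row:
  assumes "k \<le> n"
  shows "(real n + 1 - real k) * real (Suc n choose k) = (real n + 1) * real (n choose k)"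
proof -
  have "(Suc n - k) * (Suc n choose k) = Suc n * (n choose k)"
    using binomial_absorb_comp[of "Suc n" k] by simp
  then have "real (Suc n - k) * real (Suc n choose k) = real (Suc n) * real (n choose k)"
    by (metis of_nat_mult)
  with assms show ?thesis by (simp add: of_nat_diff algebra_simps)
qed

lemma binomial_next_row_next:
  "(real k + 1) * real (Suc n choose Suc k) = (real n + 1) * real (n choose k)"
proof -
  have "Suc k * (Suc n choose Suc k) = Suc n * (n choose k)"
    by (rule Suc_times_binomial)
  then have "real (Suc k) * real (Suc n choose Suc k) = real (Suc n) * real (n choose k)"
    by (metis of_nat_mult)
  then show ?thesis by (simp add: algebra_simps)
qed

text \<open>
  Every comparison below has the same form: if \<open>X = (a/b) p\<close>, a bound \<open>P/u\<close> for \<open>p\<close> becomes a bound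
  \<open>r P/v\<close> for \<open>X\<close>, where \<open>P = 2^n\<close> and \<open>r\<close> is the power of two by which the target row differs.
\<close>

lemma rescale_less:
  fixes P p X a b r u v :: real
  assumes "P / u < p" and "b * X = a * p" and "r * u * b \<le> v * a"
    and "P > 0" "a > 0" "b > 0" "u > 0" "v > 0"
  shows "r * P / v < X"
proof -
  have "(r * u * b) * P \<le> (v * a) * P"
    using assms by (intro mult_right_mono) auto
  also have "\<dots> < (v * a) * (p * u)"
    using assms by (intro mult_strict_left_mono) (auto simp: field_simps)
  also have "\<dots> = (u * b) * (X * v)"
    using assms(2) by (simp add: algebra_simps)
  finally have "(u * b) * (r * P) < (u * b) * (X * v)"
    by (simp add: algebra_simps)
  then have "r * P < X * v"
    using assms by (simp add: mult_less_cancel_left_pos)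
  then show ?thesis using assms by (simp add: field_simps)
qed

lemma rescale_le:
  fixes P p X a b r u v :: real
  assumes "p \<le> P / u" and "b * X = a * p" and "v * a \<le> r * u * b"
    and "P > 0" "a > 0" "b > 0" "u > 0" "v > 0"
  shows "X \<le> r * P / v"
proof -
  have "(u * b) * (X * v) = (v * a) * (p * u)"
    using assms(2) by (simp add: algebra_simps)
  also have "\<dots> \<le> (v * a) * P"
    using assms by (intro mult_left_mono) (auto simp: field_simps)
  also have "\<dots> \<le> (r * u * b) * P"
    using assms by (intro mult_right_mono) auto
  finally have "(u * b) * (X * v) \<le> (u * b) * (r * P)"
    by (simp add: algebra_simps)
  then have "X * v \<le> r * P"
    using assms by (simp add: mult_le_cancel_left_pos)
  then show ?thesis using assms by (simp add: field_simps)
qed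

section \<open>Propagating the window through the neighbouring rows\<close>

text \<open>
  Each of the five values below has an upper and a lower comparison: the bound \<open>lower\<close> shows that the
  proposed index passes the threshold of its row, and \<open>upper\<close> shows that its left neighbour does not.
\<close>

locale binomial_window =
  fixes n k :: nat
  assumes k_pos: "k > 0" and k_le: "2 * k + 2 \<le> n"
    and lower: "2 ^ n / (real n + 1) < real (n choose k)"
    and upper: "real (n choose k) \<le> 2 ^ n / real n"
begin

lemma real_bounds: "real k \<ge> 1" "2 * real k + 2 \<le> real n"
  using k_pos k_le by linarith+

lemma binomial_pred_row: "real n * real (n - 1 choose k) = (real n - real k) * real (n choose k)"
  using binomial_next_row[of k "n - 1"] k_pos k_le by (simp add: of_nat_diff)

lemma binomial_pred_row_pred: "real n * real (n - 1 choose (k - 1)) = real k * real (n choose k)"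
  using binomial_next_row_next[of "k - 1" "n - 1"] k_pos k_le by (simp add: of_nat_diff)

lemma f_same_row: "binom_f n = k"
proof (rule binom_f_eqI)
  have id: "(real n - real k + 1) * real (n choose (k - 1)) = real k * real (n choose k)"
    using binomial_next_row[of "k - 1" "n - 1"] binomial_pred_row_pred k_pos k_le
    by (simp add: of_nat_diff algebra_simps)
  have "(real n + 1) * real k \<le> 1 * real n * (real n - real k + 1)"
  proof -
    have "real n * (2 * real k + 2) \<le> real n * real n"
      using real_bounds by (intro mult_left_mono) auto
    then show ?thesis using real_bounds by (simp add: algebra_simps)
  qed
  from rescale_le[OF upper id this] show "real (n choose (k - 1)) \<le> 2 ^ n / (real n + 1)"
    using real_bounds by simp
qed (use k_pos k_le lower in auto)

lemma f_pred_row: "binom_f (n - 1) = k"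
proof (rule binom_f_eqI)
  have "1 / 2 * (real n + 1) * real n \<le> real n * (real n - real k)"
  proof -
    have "real n * (2 * real k + 1) \<le> real n * real n"
      using real_bounds by (intro mult_left_mono) auto
    then show ?thesis by (simp add: algebra_simps add_divide_distrib)
  qed
  from rescale_less[OF lower binomial_pred_row this]
  show "2 ^ (n - 1) / (real (n - 1) + 1) < real (n - 1 choose k)"
    using real_bounds k_le by (simp add: of_nat_diff power_diff)
  have "real n * real k \<le> 1 / 2 * real n * real n"
  proof -
    have "real n * (2 * real k) \<le> real n * real n"
      using real_bounds by (intro mult_left_mono) auto
    then show ?thesis by (simp add: algebra_simps)
  qed
  from rescale_le[OF upper binomial_pred_row_pred this]
  show "real (n - 1 choose (k - 1)) \<le> 2 ^ (n - 1) / (real (n - 1) + 1)"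
    using real_bounds k_le by (simp add: of_nat_diff power_diff)
qed (use k_pos k_le in auto)

lemma f_pred2_row: "binom_f (n - 2) = k"
proof (rule binom_f_eqI)
  have suc: "Suc (n - 2) = n - 1" using k_le by simp
  have id1: "(real n * (real n - 1)) * real (n - 2 choose k)
      = ((real n - real k) * (real n - real k - 1)) * real (n choose k)"
  proof -
    have "(real n - 1 - real k) * real (n - 1 choose k) = (real n - 1) * real (n - 2 choose k)"
      using binomial_next_row[of k "n - 2"] k_le suc by (simp add: of_nat_diff)
    with binomial_pred_row show ?thesis
      by (metis (no_types, opaque_lifting) diff_diff_eq2 diff_right_commute mult.assoc mult.left_commute)
  qed
  have "1 / 4 * (real n + 1) * (real n * (real n - 1))
      \<le> (real n - 1) * ((real n - real k) * (real n - real k - 1))"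
  proof -
    have "(real n / 2 + 1) * (real n / 2) \<le> (real n - real k) * (real n - real k - 1)"
      using real_bounds by (intro mult_mono) auto
    then have "1 / 4 * (real n + 1) * real n \<le> (real n - real k) * (real n - real k - 1)"
      using real_bounds by (simp add: algebra_simps add_divide_distrib)
    then have "(real n - 1) * (1 / 4 * (real n + 1) * real n)
        \<le> (real n - 1) * ((real n - real k) * (real n - real k - 1))"
      using real_bounds by (intro mult_left_mono) auto
    then show ?thesis by (simp add: algebra_simps)
  qed
  from rescale_less[OF lower id1 this]
  show "2 ^ (n - 2) / (real (n - 2) + 1) < real (n - 2 choose k)"
    using real_bounds k_le by (simp add: of_nat_diff power_diff)
  have id2: "(real n * (real n - 1)) * real (n - 2 choose (k - 1))
      = (real k * (real n - real k)) * real (n choose k)"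
  proof -
    have "(real n - real k) * real (n - 1 choose (k - 1)) = (real n - 1) * real (n - 2 choose (k - 1))"
      using binomial_next_row[of "k - 1" "n - 2"] k_pos k_le suc by (simp add: of_nat_diff)
    with binomial_pred_row_pred show ?thesis
      by (metis (no_types, opaque_lifting) mult.assoc mult.left_commute)
  qed
  have "(real n - 1) * (real k * (real n - real k)) \<le> 1 / 4 * real n * (real n * (real n - 1))"
  proof -
    \<comment> \<open>arithmetic and geometric mean of \<open>k\<close> and \<open>n - k\<close>\<close>
    have "0 \<le> (real n - 2 * real k) ^ 2" by simp
    then have "real k * (real n - real k) \<le> 1 / 4 * real n * real n"
      by (simp add: power2_eq_square algebra_simps)
    then have "(real n - 1) * (real k * (real n - real k)) \<le> (real n - 1) * (1 / 4 * real n * real n)"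
      using real_bounds by (intro mult_left_mono) auto
    then show ?thesis by (simp add: algebra_simps)
  qed
  from rescale_le[OF upper id2 this]
  show "real (n - 2 choose (k - 1)) \<le> 2 ^ (n - 2) / (real (n - 2) + 1)"
    using real_bounds k_le by (simp add: of_nat_diff power_diff)
qed (use k_pos k_le in auto)

lemma L_next_row: "binom_L (n + 1) = k + 1"
proof (rule binom_L_eqI)
  have id1: "(real k + 1) * real (n + 1 choose (k + 1)) = (real n + 1) * real (n choose k)"
    using binomial_next_row_next[of k n] by simp
  have "2 * (real n + 1) * (real k + 1) \<le> (real n + 1) * (real n + 1)"
  proof -
    have "(real n + 1) * (2 * (real k + 1)) \<le> (real n + 1) * (real n + 1)"
      using real_bounds by (intro mult_left_mono) auto
    then show ?thesis by (simp add: algebra_simps)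
  qed
  from rescale_less[OF lower id1 this]
  show "2 ^ (n + 1) / real (n + 1) < real (n + 1 choose (k + 1))"
    by (simp add: add.commute)
  have id2: "(real n + 1 - real k) * real (n + 1 choose k) = (real n + 1) * real (n choose k)"
    using binomial_next_row[of k n] k_le by simp
  have "(real n + 1) * (real n + 1) \<le> 2 * real n * (real n + 1 - real k)"
  proof -
    have "real n * (2 * real k + 2) \<le> real n * real n"
      using real_bounds by (intro mult_left_mono) auto
    then show ?thesis using real_bounds by (simp add: algebra_simps)
  qed
  from rescale_le[OF upper id2 this]
  show "real (n + 1 choose (k + 1 - 1)) \<le> 2 ^ (n + 1) / real (n + 1)"
    using real_bounds by (simp add: add.commute)
qed (use k_pos k_le in auto)

lemma L_next2_row: "binom_L (n + 2) = k + 1"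
proof (rule binom_L_eqI)
  have row1: "(real n + 1 - real k) * real (n + 1 choose k) = (real n + 1) * real (n choose k)"
    using binomial_next_row[of k n] k_le by simp
  have id1: "((real k + 1) * (real n + 1 - real k)) * real (n + 2 choose (k + 1))
      = ((real n + 2) * (real n + 1)) * real (n choose k)"
  proof -
    have "(real k + 1) * real (n + 2 choose (k + 1)) = (real n + 2) * real (n + 1 choose k)"
      using binomial_next_row_next[of k "n + 1"] by simp
    with row1 show ?thesis
      by (metis (no_types, opaque_lifting) mult.assoc mult.left_commute)
  qed
  have "4 * (real n + 1) * ((real k + 1) * (real n + 1 - real k))
      \<le> (real n + 2) * ((real n + 2) * (real n + 1))"
  proof -
    \<comment> \<open>arithmetic and geometric mean of \<open>k + 1\<close> and \<open>n + 1 - k\<close>\<close>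
    have "0 \<le> (real n - 2 * real k) ^ 2" by simp
    then have "4 * ((real k + 1) * (real n + 1 - real k)) \<le> (real n + 2) * (real n + 2)"
      by (simp add: power2_eq_square algebra_simps)
    then have "(real n + 1) * (4 * ((real k + 1) * (real n + 1 - real k)))
        \<le> (real n + 1) * ((real n + 2) * (real n + 2))"
      by (intro mult_left_mono) auto
    then show ?thesis by (simp add: algebra_simps)
  qed
  from rescale_less[OF lower id1 this]
  show "2 ^ (n + 2) / real (n + 2) < real (n + 2 choose (k + 1))"
    using real_bounds by (simp add: add.commute)
  have id2: "((real n + 2 - real k) * (real n + 1 - real k)) * real (n + 2 choose k)
      = ((real n + 2) * (real n + 1)) * real (n choose k)"
  proof -
    have "(real n + 2 - real k) * real (n + 2 choose k) = (real n + 2) * real (n + 1 choose k)"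
      using binomial_next_row[of k "n + 1"] k_le by (simp add: add.commute)
    with row1 show ?thesis
      by (metis (no_types, opaque_lifting) mult.assoc mult.left_commute)
  qed
  have "(real n + 2) * ((real n + 2) * (real n + 1))
      \<le> 4 * real n * ((real n + 2 - real k) * (real n + 1 - real k))"
  proof -
    have "(real n / 2 + 3) * (real n / 2 + 2) \<le> (real n + 2 - real k) * (real n + 1 - real k)"
      using real_bounds by (intro mult_mono) auto
    then have "4 * real n * ((real n / 2 + 3) * (real n / 2 + 2))
        \<le> 4 * real n * ((real n + 2 - real k) * (real n + 1 - real k))"
      by (intro mult_left_mono) auto
    moreover have "(real n + 2) * ((real n + 2) * (real n + 1))
        \<le> 4 * real n * ((real n / 2 + 3) * (real n / 2 + 2))"
    proof -
      have "0 \<le> real n * (real n * 5)" by simp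
      moreover have "4 \<le> real n * 16" using real_bounds by linarith
      ultimately have "4 \<le> real n * 16 + real n * (real n * 5)" by linarith
      then show ?thesis by (simp add: algebra_simps)
    qed
    ultimately show ?thesis by linarith
  qed
  from rescale_le[OF upper id2 this]
  show "real (n + 2 choose (k + 1 - 1)) \<le> 2 ^ (n + 2) / real (n + 2)"
    using real_bounds by (simp add: add.commute)
qed (use k_pos k_le in auto)

end

theorem theorem1p4:
  fixes n :: nat
  assumes "n \<ge> 3"
    and "real (n choose (binom_L n - 1)) > 2 ^ n / (real n + 1)"
  shows "(binom_f n = binom_f (n - 1) \<and> binom_f (n - 1) = binom_f (n - 2)
            \<and> binom_f (n - 2) = binom_L n - 1)
       \<and> (binom_L n = binom_L (n + 1) \<and> binom_L (n + 1) = binom_L (n + 2)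
            \<and> binom_L (n + 2) = binom_f n + 1)"
proof -
  define k where "k = binom_L n - 1"
  have L: "binom_L n = k + 1"
    using binom_L_greater(1)[OF assms(1)] by (simp add: k_def)
  have lower: "2 ^ n / (real n + 1) < real (n choose k)"
    using assms(2) by (simp add: k_def)
  have k_pos: "k > 0"
  proof (rule ccontr)
    assume "\<not> k > 0"
    with lower have "2 ^ n < real n + 1" by (simp add: field_simps)
    moreover have "Suc n \<le> 2 ^ n" by (simp add: Suc_leI)
    then have "real (Suc n) \<le> 2 ^ n"
      by (metis of_nat_le_iff of_nat_numeral of_nat_power)
    ultimately show False by simp
  qed
  have "real (n choose k) \<le> 2 ^ n / real n"
    using binom_L_le[of k n] k_pos L by (fastforce simp: not_less[symmetric])
  then interpret binomial_window n k
    using k_pos lower binom_L_le_half[OF assms(1)] L by unfold_locales auto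
  show ?thesis
    using L by (simp only: f_same_row f_pred_row f_pred2_row L_next_row L_next2_row) simp
qed

end
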